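(* Let $\mathbb{X}=[X_1\rightrightarrows X_0]$ and $\mathbb{Y}=[Y_1\rightrightarrows Y_0]$ be Lie groupoids equipped with integrable connections $\mathcal{H}_X\subseteq TX_1$ and $\mathcal{H}_Y\subseteq TY_1$ respectively, and let $(F_1,F_0)\colon[X_1\rightrightarrows X_0]\to[Y_1\rightrightarrows Y_0]$ be a morphism of Lie groupoids compatible with the connections $\mathcal{H}_X$ and $\mathcal{H}_Y$. Let $\omega$ be a differential $k$-form on $Y_0$, and $F_0^*\omega$ the pull-back of $\omega$ along $F_0\colon X_0\to Y_0$. If $\omega$ is a $k$-form on $(\mathbb{Y},\mathcal{H}_Y)$, then $F_0^*\omega$ is a $k$-form on $(\mathbb{X},\mathcal{H}_X)$.
   Context: A Lie groupoid $[X_1\rightrightarrows X_0]$ is a groupoid with smooth manifolds of objects $X_0$ and arrows $X_1$, smooth structure maps, and submersive source and target maps $s,t\colon X_1\to X_0$; $e\colon X_0\to X_1$, $a\mapsto 1_a$, is the unit map; a morphism of Lie groupoids is a smooth functor. A connection on $[X_1\rightrightarrows X_0]$ is a sub-bundle $\mathcal{H}\subseteq TX_1$ with $T_\gamma X_1=\mathcal{H}_\gamma X_1\oplus\ker(s_{*,\gamma})$ for all $\gamma\in X_1$ such that, writing $\theta_\gamma=t_{*,\gamma}\circ(s_{*,\gamma}|_{\mathcal{H}_\gamma X_1})^{-1}\colon T_{s(\gamma)}X_0\to T_{t(\gamma)}X_0$, one has (1) $\theta_{\gamma\circ\gamma'}=\theta_\gamma\circ\theta_{\gamma'}$ for all composable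 $\gamma,\gamma'$, and (2) $e_{*,a}(T_aX_0)=\mathcal{H}_{1_a}$ for all $a\in X_0$. It is integrable if the Lie bracket of any two vector fields on $X_1$ with values in $\mathcal{H}$ has values in $\mathcal{H}$. For $v\in T_\gamma X_1$, $\mathcal{H}_\gamma(v)$ denotes the component of $v$ in $\mathcal{H}_\gamma X_1$. For a differential $k$-form $\eta$ on $X_1$, $\mathcal{H}(\eta)$ is the $k$-form $\mathcal{H}(\eta)(\gamma)(v_1,\dots,v_k)=\eta(\gamma)(\mathcal{H}_\gamma(v_1),\dots,\mathcal{H}_\gamma(v_k))$. A differential $k$-form on $(\mathbb{X},\mathcal{H})$ is a differential $k$-form $\omega$ on the manifold $X_0$ such that $\mathcal{H}(s^*\omega)=\mathcal{H}(t^*\omega)$. A morphism $(F_1,F_0)$ is compatible with the connections $\mathcal{H}_X,\mathcal{H}_Y$ if $(F_1)_{*,\gamma}$ sends the $\mathcal{H}_X$-horizontal component of $v$ to the $\mathcal{H}_Y$-horizontal component of $(F_1)_{*,\gamma}(v)$, for all $\gamma\in X_1$ and $v\in T_\gamma X_1$. *)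

theory Defs
  imports "HOL-Analysis.Analysis"
begin

section \<open>Smooth functions between normed spaces\<close>

text \<open>
  Only used for open \<open>S\<close> and a finite-dimensional domain, where continuity of all iterated
  directional derivatives, together with differentiability at each stage, is the usual \<open>C\<^sup>n\<close>.
\<close>

primrec times_diff_on ::
  "nat \<Rightarrow> ('a::real_normed_vector \<Rightarrow> 'b::real_normed_vector) \<Rightarrow> 'a set \<Rightarrow> bool" where
  "times_diff_on 0 f S \<longleftrightarrow> continuous_on S f"
| "times_diff_on (Suc n) f S \<longleftrightarrow>
     (\<forall>x\<in>S. f differentiable (at x)) \<and>
     (\<forall>v. times_diff_on n (\<lambda>x. frechet_derivative f (at x) v) S)"

definition smooth_on ::
  "('a::real_normed_vector \<Rightarrow> 'b::real_normed_vector) \<Rightarrow> 'a set \<Rightarrow> bool" where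
  "smooth_on f S \<longleftrightarrow> (\<forall>n. times_diff_on n f S)"


section \<open>Smooth manifolds\<close>

text \<open>
  A chart is a domain together with a coordinate function, whose values outside the domain are
  irrelevant. The model space \<open>'e\<close> is a finite-dimensional real normed space; the class
  \<open>euclidean_space\<close> is deliberately not used, since it excludes dimension \<open>0\<close>.
  The points of a manifold are the \<open>topspace\<close> of its topology. The atlas need not be maximal.
\<close>

type_synonym ('a, 'e) chart = "'a set \<times> ('a \<Rightarrow> 'e)"

abbreviation cdom :: "('a, 'e) chart \<Rightarrow> 'a set" where
  "cdom c \<equiv> fst c"

abbreviation coord :: "('a, 'e) chart \<Rightarrow> 'a \<Rightarrow> 'e" where
  "coord c \<equiv> snd c"

definition chart_inv :: "('a, 'e) chart \<Rightarrow> 'e \<Rightarrow> 'a" where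
  "chart_inv c = inv_into (cdom c) (coord c)"

record ('a, 'e) manifold =
  mtop :: "'a topology"
  atlas :: "('a, 'e) chart set"

abbreviation points :: "('a, 'e) manifold \<Rightarrow> 'a set" where
  "points M \<equiv> topspace (mtop M)"

definition is_chart :: "'a topology \<Rightarrow> ('a, 'e::real_normed_vector) chart \<Rightarrow> bool" where
  "is_chart T c \<longleftrightarrow>
     openin T (cdom c) \<and> open (coord c ` cdom c) \<and>
     homeomorphic_map (subtopology T (cdom c)) (top_of_set (coord c ` cdom c)) (coord c)"

definition smooth_manifold :: "('a, 'e::real_normed_vector) manifold \<Rightarrow> bool" where
  "smooth_manifold M \<longleftrightarrow>
     (\<exists>B::'e set. finite B \<and> span B = UNIV) \<and>
     Hausdorff_space (mtop M) \<and> second_countable (mtop M) \<and>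
     (\<forall>c\<in>atlas M. is_chart (mtop M) c) \<and>
     (\<Union>c\<in>atlas M. cdom c) = points M \<and>
     (\<forall>c\<in>atlas M. \<forall>d\<in>atlas M.
        smooth_on (\<lambda>x. coord d (chart_inv c x)) (coord c ` (cdom c \<inter> cdom d)))"

definition prod_manifold :: "('a, 'e) manifold \<Rightarrow> ('b, 'f) manifold \<Rightarrow> ('a \<times> 'b, 'e \<times> 'f) manifold"
  where
  "prod_manifold M N =
     \<lparr>mtop = prod_topology (mtop M) (mtop N),
      atlas = {(cdom c \<times> cdom d, \<lambda>p. (coord c (fst p), coord d (snd p))) |c d.
                 c \<in> atlas M \<and> d \<in> atlas N}\<rparr>"


subsection \<open>Smooth maps\<close>

definition smooth_map_on ::
  "('a, 'e::real_normed_vector) manifold \<Rightarrow> 'a set \<Rightarrow>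
   ('b, 'f::real_normed_vector) manifold \<Rightarrow> ('a \<Rightarrow> 'b) \<Rightarrow> bool" where
  "smooth_map_on M U N f \<longleftrightarrow>
     openin (mtop M) U \<and>
     continuous_map (subtopology (mtop M) U) (mtop N) f \<and>
     (\<forall>c\<in>atlas M. \<forall>d\<in>atlas N.
        smooth_on (\<lambda>x. coord d (f (chart_inv c x)))
          (coord c ` {p \<in> cdom c \<inter> U. f p \<in> cdom d}))"

abbreviation smooth_map ::
  "('a, 'e::real_normed_vector) manifold \<Rightarrow>
   ('b, 'f::real_normed_vector) manifold \<Rightarrow> ('a \<Rightarrow> 'b) \<Rightarrow> bool" where
  "smooth_map M N f \<equiv> smooth_map_on M (points M) N f"

text \<open>
  Smoothness on an arbitrary subset: locally the restriction of a smooth map on an open set. For an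
  embedded submanifold this is smoothness for the submanifold structure.
\<close>

definition smooth_on_subset ::
  "('a, 'e::real_normed_vector) manifold \<Rightarrow> 'a set \<Rightarrow>
   ('b, 'f::real_normed_vector) manifold \<Rightarrow> ('a \<Rightarrow> 'b) \<Rightarrow> bool" where
  "smooth_on_subset M S N f \<longleftrightarrow>
     S \<subseteq> points M \<and>
     (\<forall>p\<in>S. \<exists>U g. p \<in> U \<and> smooth_map_on M U N g \<and> (\<forall>q\<in>S \<inter> U. g q = f q))"


subsection \<open>Tangent spaces\<close>

text \<open>
  \<open>T\<^sub>pM\<close> is the model space \<open>'e\<close>, a vector being given by its components in the
  chosen chart \<open>chart_at M p\<close> around \<open>p\<close>. The maps \<open>tan_comp\<close> and
  \<open>tan_of_comp\<close> pass from \<open>T\<^sub>pM\<close> to components in another chart around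
  \<open>p\<close> and back; regularity of sections of bundles is always measured in arbitrary charts
  of the atlas, so the choice (which need not vary continuously with \<open>p\<close>) does not matter.
\<close>

definition chart_at :: "('a, 'e) manifold \<Rightarrow> 'a \<Rightarrow> ('a, 'e) chart" where
  "chart_at M p = (SOME c. c \<in> atlas M \<and> p \<in> cdom c)"

definition pushforward ::
  "('a, 'e::real_normed_vector) manifold \<Rightarrow> ('b, 'f::real_normed_vector) manifold \<Rightarrow>
   ('a \<Rightarrow> 'b) \<Rightarrow> 'a \<Rightarrow> 'e \<Rightarrow> 'f" where
  "pushforward M N f p =
     frechet_derivative (\<lambda>x. coord (chart_at N (f p)) (f (chart_inv (chart_at M p) x)))
       (at (coord (chart_at M p) p))"

definition tan_comp ::
  "('a, 'e::real_normed_vector) manifold \<Rightarrow> ('a, 'e) chart \<Rightarrow> 'a \<Rightarrow> 'e \<Rightarrow> 'e" where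
  "tan_comp M c p =
     frechet_derivative (\<lambda>x. coord c (chart_inv (chart_at M p) x)) (at (coord (chart_at M p) p))"

definition tan_of_comp ::
  "('a, 'e::real_normed_vector) manifold \<Rightarrow> ('a, 'e) chart \<Rightarrow> 'a \<Rightarrow> 'e \<Rightarrow> 'e" where
  "tan_of_comp M c p =
     frechet_derivative (\<lambda>x. coord (chart_at M p) (chart_inv c x)) (at (coord c p))"


subsection \<open>Vector fields, sub-bundles of the tangent bundle\<close>

definition local_field ::
  "('a, 'e::real_normed_vector) manifold \<Rightarrow> ('a, 'e) chart \<Rightarrow> ('a \<Rightarrow> 'e) \<Rightarrow> 'e \<Rightarrow> 'e" where
  "local_field M c V x = tan_comp M c (chart_inv c x) (V (chart_inv c x))"

definition vector_field_on ::
  "('a, 'e::real_normed_vector) manifold \<Rightarrow> 'a set \<Rightarrow> ('a \<Rightarrow> 'e) \<Rightarrow> bool" where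
  "vector_field_on M U V \<longleftrightarrow>
     openin (mtop M) U \<and> (\<forall>c\<in>atlas M. smooth_on (local_field M c V) (coord c ` (cdom c \<inter> U)))"

text \<open>The coordinate formula \<open>[V, W] = DW(V) - DV(W)\<close>, evaluated in the chart \<open>chart_at M p\<close>.\<close>

definition lie_bracket ::
  "('a, 'e::real_normed_vector) manifold \<Rightarrow> ('a \<Rightarrow> 'e) \<Rightarrow> ('a \<Rightarrow> 'e) \<Rightarrow> 'a \<Rightarrow> 'e" where
  "lie_bracket M V W p =
     (let c = chart_at M p; x = coord c p; V' = local_field M c V; W' = local_field M c W
      in frechet_derivative W' (at x) (V' x) - frechet_derivative V' (at x) (W' x))"

text \<open>A smooth sub-bundle is a family of subspaces with local smooth frames.\<close>

definition tangent_subbundle ::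
  "('a, 'e::real_normed_vector) manifold \<Rightarrow> ('a \<Rightarrow> 'e set) \<Rightarrow> bool" where
  "tangent_subbundle M H \<longleftrightarrow>
     (\<forall>p\<in>points M. \<exists>U r (E :: nat \<Rightarrow> 'a \<Rightarrow> 'e).
        p \<in> U \<and> openin (mtop M) U \<and>
        (\<forall>i<r. vector_field_on M U (E i)) \<and>
        (\<forall>q\<in>U. inj_on (\<lambda>i. E i q) {..<r} \<and>
                independent ((\<lambda>i. E i q) ` {..<r}) \<and>
                span ((\<lambda>i. E i q) ` {..<r}) = H q))"


subsection \<open>Differential forms\<close>

text \<open>
  A \<open>k\<close>-form takes its \<open>k\<close> arguments as a sequence \<open>v :: nat \<Rightarrow> 'e\<close> of which only
  the entries \<open>v 0, \<dots>, v (k - 1)\<close> are used.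
\<close>

type_synonym ('a, 'e) form = "'a \<Rightarrow> (nat \<Rightarrow> 'e) \<Rightarrow> real"

definition alternating_form :: "nat \<Rightarrow> ((nat \<Rightarrow> 'e::real_vector) \<Rightarrow> real) \<Rightarrow> bool" where
  "alternating_form k \<alpha> \<longleftrightarrow>
     (\<forall>v w. (\<forall>i<k. v i = w i) \<longrightarrow> \<alpha> v = \<alpha> w) \<and>
     (\<forall>v. \<forall>i<k. linear (\<lambda>x. \<alpha> (v(i := x)))) \<and>
     (\<forall>v. \<forall>i<k. \<forall>j<k. i \<noteq> j \<and> v i = v j \<longrightarrow> \<alpha> v = 0)"

definition differential_form ::
  "nat \<Rightarrow> ('a, 'e::real_normed_vector) manifold \<Rightarrow> ('a, 'e) form \<Rightarrow> bool" where
  "differential_form k M \<omega> \<longleftrightarrow>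
     (\<forall>p\<in>points M. alternating_form k (\<omega> p)) \<and>
     (\<forall>c\<in>atlas M. \<forall>v :: nat \<Rightarrow> 'e.
        smooth_on (\<lambda>x. \<omega> (chart_inv c x) (\<lambda>i. tan_of_comp M c (chart_inv c x) (v i)))
          (coord c ` cdom c))"

definition pullback ::
  "('a, 'e::real_normed_vector) manifold \<Rightarrow> ('b, 'f::real_normed_vector) manifold \<Rightarrow>
   ('a \<Rightarrow> 'b) \<Rightarrow> ('b, 'f) form \<Rightarrow> ('a, 'e) form" where
  "pullback M N f \<omega> p v = \<omega> (f p) (\<lambda>i. pushforward M N f p (v i))"


section \<open>Lie groupoids\<close>

text \<open>\<open>cmp G \<gamma> \<gamma>'\<close> is \<open>\<gamma> \<circ> \<gamma>'\<close>, meaningful when \<open>src G \<gamma> = tgt G \<gamma>'\<close>.\<close>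

record ('b, 'g, 'a, 'e) groupoid =
  arr :: "('b, 'g) manifold"
  obj :: "('a, 'e) manifold"
  src :: "'b \<Rightarrow> 'a"
  tgt :: "'b \<Rightarrow> 'a"
  unt :: "'a \<Rightarrow> 'b"
  cmp :: "'b \<Rightarrow> 'b \<Rightarrow> 'b"
  ivs :: "'b \<Rightarrow> 'b"

definition composable :: "('b, 'g, 'a, 'e) groupoid \<Rightarrow> ('b \<times> 'b) set" where
  "composable G = {(\<gamma>, \<gamma>'). \<gamma> \<in> points (arr G) \<and> \<gamma>' \<in> points (arr G) \<and> src G \<gamma> = tgt G \<gamma>'}"

abbreviation src_push ::
  "('b, 'g::real_normed_vector, 'a, 'e::real_normed_vector) groupoid \<Rightarrow> 'b \<Rightarrow> 'g \<Rightarrow> 'e" where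
  "src_push G \<gamma> \<equiv> pushforward (arr G) (obj G) (src G) \<gamma>"

abbreviation tgt_push ::
  "('b, 'g::real_normed_vector, 'a, 'e::real_normed_vector) groupoid \<Rightarrow> 'b \<Rightarrow> 'g \<Rightarrow> 'e" where
  "tgt_push G \<gamma> \<equiv> pushforward (arr G) (obj G) (tgt G) \<gamma>"

definition groupoid_laws :: "('b, 'g, 'a, 'e) groupoid \<Rightarrow> bool" where
  "groupoid_laws G \<longleftrightarrow>
     (\<forall>\<gamma>\<in>points (arr G). src G \<gamma> \<in> points (obj G) \<and> tgt G \<gamma> \<in> points (obj G)) \<and>
     (\<forall>a\<in>points (obj G). unt G a \<in> points (arr G) \<and>
        src G (unt G a) = a \<and> tgt G (unt G a) = a) \<and>
     (\<forall>(\<gamma>, \<gamma>')\<in>composable G. cmp G \<gamma> \<gamma>' \<in> points (arr G) \<and>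
        src G (cmp G \<gamma> \<gamma>') = src G \<gamma>' \<and> tgt G (cmp G \<gamma> \<gamma>') = tgt G \<gamma>) \<and>
     (\<forall>\<gamma> \<gamma>' \<gamma>''. (\<gamma>, \<gamma>') \<in> composable G \<and> (\<gamma>', \<gamma>'') \<in> composable G \<longrightarrow>
        cmp G (cmp G \<gamma> \<gamma>') \<gamma>'' = cmp G \<gamma> (cmp G \<gamma>' \<gamma>'')) \<and>
     (\<forall>\<gamma>\<in>points (arr G).
        cmp G \<gamma> (unt G (src G \<gamma>)) = \<gamma> \<and> cmp G (unt G (tgt G \<gamma>)) \<gamma> = \<gamma>) \<and>
     (\<forall>\<gamma>\<in>points (arr G). ivs G \<gamma> \<in> points (arr G) \<and>
        src G (ivs G \<gamma>) = tgt G \<gamma> \<and> tgt G (ivs G \<gamma>) = src G \<gamma> \<and>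
        cmp G \<gamma> (ivs G \<gamma>) = unt G (tgt G \<gamma>) \<and> cmp G (ivs G \<gamma>) \<gamma> = unt G (src G \<gamma>))"

definition lie_groupoid ::
  "('b, 'g::real_normed_vector, 'a, 'e::real_normed_vector) groupoid \<Rightarrow> bool" where
  "lie_groupoid G \<longleftrightarrow>
     smooth_manifold (arr G) \<and> smooth_manifold (obj G) \<and> groupoid_laws G \<and>
     smooth_map (arr G) (obj G) (src G) \<and>
     smooth_map (arr G) (obj G) (tgt G) \<and>
     (\<forall>\<gamma>\<in>points (arr G). surj (src_push G \<gamma>) \<and> surj (tgt_push G \<gamma>)) \<and>
     smooth_map (obj G) (arr G) (unt G) \<and>
     smooth_map (arr G) (arr G) (ivs G) \<and>
     smooth_on_subset (prod_manifold (arr G) (arr G)) (composable G) (arr G)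
       (\<lambda>(\<gamma>, \<gamma>'). cmp G \<gamma> \<gamma>')"

definition lie_groupoid_morphism ::
  "('b, 'g::real_normed_vector, 'a, 'e::real_normed_vector) groupoid \<Rightarrow>
   ('d, 'h::real_normed_vector, 'c, 'f::real_normed_vector) groupoid \<Rightarrow>
   ('b \<Rightarrow> 'd) \<Rightarrow> ('a \<Rightarrow> 'c) \<Rightarrow> bool" where
  "lie_groupoid_morphism X Y F1 F0 \<longleftrightarrow>
     smooth_map (arr X) (arr Y) F1 \<and> smooth_map (obj X) (obj Y) F0 \<and>
     (\<forall>\<gamma>\<in>points (arr X). src Y (F1 \<gamma>) = F0 (src X \<gamma>) \<and> tgt Y (F1 \<gamma>) = F0 (tgt X \<gamma>)) \<and>
     (\<forall>a\<in>points (obj X). F1 (unt X a) = unt Y (F0 a)) \<and>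
     (\<forall>(\<gamma>, \<gamma>')\<in>composable X. F1 (cmp X \<gamma> \<gamma>') = cmp Y (F1 \<gamma>) (F1 \<gamma>'))"


subsection \<open>Connections\<close>

definition direct_sum_decomposition :: "'v::real_vector set \<Rightarrow> 'v set \<Rightarrow> bool" where
  "direct_sum_decomposition A B \<longleftrightarrow>
     subspace A \<and> subspace B \<and> A \<inter> B = {0} \<and> (\<forall>v. \<exists>a\<in>A. \<exists>b\<in>B. v = a + b)"

definition vertical ::
  "('b, 'g::real_normed_vector, 'a, 'e::real_normed_vector) groupoid \<Rightarrow> 'b \<Rightarrow> 'g set" where
  "vertical G \<gamma> = {v. src_push G \<gamma> v = 0}"

text \<open>\<open>\<theta>\<close>: the inverse is that of the restriction of the differential of \<open>src\<close> to \<open>H \<gamma>\<close>.\<close>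

definition transport ::
  "('b, 'g::real_normed_vector, 'a, 'e::real_normed_vector) groupoid \<Rightarrow> ('b \<Rightarrow> 'g set) \<Rightarrow>
   'b \<Rightarrow> 'e \<Rightarrow> 'e" where
  "transport G H \<gamma> = tgt_push G \<gamma> \<circ> inv_into (H \<gamma>) (src_push G \<gamma>)"

definition connection ::
  "('b, 'g::real_normed_vector, 'a, 'e::real_normed_vector) groupoid \<Rightarrow> ('b \<Rightarrow> 'g set) \<Rightarrow> bool"
  where
  "connection G H \<longleftrightarrow>
     tangent_subbundle (arr G) H \<and>
     (\<forall>\<gamma>\<in>points (arr G). direct_sum_decomposition (H \<gamma>) (vertical G \<gamma>)) \<and>
     (\<forall>(\<gamma>, \<gamma>')\<in>composable G.
        transport G H (cmp G \<gamma> \<gamma>') = transport G H \<gamma> \<circ> transport G H \<gamma>') \<and>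
     (\<forall>a\<in>points (obj G). range (pushforward (obj G) (arr G) (unt G) a) = H (unt G a))"

definition integrable_connection ::
  "('b, 'g::real_normed_vector, 'a, 'e::real_normed_vector) groupoid \<Rightarrow> ('b \<Rightarrow> 'g set) \<Rightarrow> bool"
  where
  "integrable_connection G H \<longleftrightarrow>
     connection G H \<and>
     (\<forall>V W. vector_field_on (arr G) (points (arr G)) V \<and>
            vector_field_on (arr G) (points (arr G)) W \<and>
            (\<forall>\<gamma>\<in>points (arr G). V \<gamma> \<in> H \<gamma> \<and> W \<gamma> \<in> H \<gamma>) \<longrightarrow>
            (\<forall>\<gamma>\<in>points (arr G). lie_bracket (arr G) V W \<gamma> \<in> H \<gamma>))"

definition hor ::
  "('b, 'g::real_normed_vector, 'a, 'e::real_normed_vector) groupoid \<Rightarrow> ('b \<Rightarrow> 'g set) \<Rightarrow>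
   'b \<Rightarrow> 'g \<Rightarrow> 'g" where
  "hor G H \<gamma> v = (THE h. h \<in> H \<gamma> \<and> v - h \<in> vertical G \<gamma>)"

definition compatible ::
  "('b, 'g::real_normed_vector, 'a, 'e::real_normed_vector) groupoid \<Rightarrow> ('b \<Rightarrow> 'g set) \<Rightarrow>
   ('d, 'h::real_normed_vector, 'c, 'f::real_normed_vector) groupoid \<Rightarrow> ('d \<Rightarrow> 'h set) \<Rightarrow>
   ('b \<Rightarrow> 'd) \<Rightarrow> bool" where
  "compatible X HX Y HY F1 \<longleftrightarrow>
     (\<forall>\<gamma>\<in>points (arr X). \<forall>v.
        pushforward (arr X) (arr Y) F1 \<gamma> (hor X HX \<gamma> v) =
        hor Y HY (F1 \<gamma>) (pushforward (arr X) (arr Y) F1 \<gamma> v))"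


subsection \<open>Forms on a Lie groupoid with connection\<close>

definition hor_form ::
  "('b, 'g::real_normed_vector, 'a, 'e::real_normed_vector) groupoid \<Rightarrow> ('b \<Rightarrow> 'g set) \<Rightarrow>
   ('b, 'g) form \<Rightarrow> ('b, 'g) form" where
  "hor_form G H \<eta> \<gamma> v = \<eta> \<gamma> (\<lambda>i. hor G H \<gamma> (v i))"

definition groupoid_form ::
  "nat \<Rightarrow> ('b, 'g::real_normed_vector, 'a, 'e::real_normed_vector) groupoid \<Rightarrow>
   ('b \<Rightarrow> 'g set) \<Rightarrow> ('a, 'e) form \<Rightarrow> bool" where
  "groupoid_form k G H \<omega> \<longleftrightarrow>
     differential_form k (obj G) \<omega> \<and>
     (\<forall>\<gamma>\<in>points (arr G).
        hor_form G H (pullback (arr G) (obj G) (src G) \<omega>) \<gamma> =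
        hor_form G H (pullback (arr G) (obj G) (tgt G) \<omega>) \<gamma>)"

end

theory Submission
  imports Defs
begin

text \<open>
  Both conditions reduce to one chain rule for coordinate representations, of which the rules for
  \<open>pushforward\<close> and \<open>tan_of_comp\<close> are instances. Since \<open>F\<^sub>0 s = s F\<^sub>1\<close> and \<open>F\<^sub>1\<close> preserves horizontal
  components, \<open>\<H>(s\<^sup>* F\<^sub>0\<^sup>* \<omega>) = F\<^sub>1\<^sup>* \<H>(s\<^sup>* \<omega>)\<close>, and likewise for \<open>t\<close>. That \<open>F\<^sub>0\<^sup>* \<omega>\<close> is smooth follows by
  expanding the derivative of \<open>F\<^sub>0\<close> in a basis of the model space, whose coordinate functionals are
  bounded.
\<close>

section \<open>Coordinate functionals in finite dimension\<close>

text \<open>For nonzero t, dividing \<open>t a + u\<close> by t leaves \<open>a\<close> plus a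
  vector of \<open>span S\<close>, whose norm is at least the distance from \<open>a\<close> to the
  closed set \<open>span S\<close>. The constant K is the reciprocal of that distance.\<close>

lemma span_insert_scalar_bound:
  fixes a :: "'a::real_normed_vector"
  assumes "closed (span S)" "a \<notin> span S"
  obtains K where "0 < K" "\<And>t u. u \<in> span S \<Longrightarrow> \<bar>t\<bar> \<le> K * norm (t *\<^sub>R a + u)"
proof -
  have pos: "0 < infdist a (span S)"
    using assms infdist_pos_not_in_closed[of "span S" a] span_zero by blast
  have "infdist a (span S) * \<bar>t\<bar> \<le> norm (t *\<^sub>R a + u)" if u: "u \<in> span S" for t u
  proof (cases "t = 0")
    case False
    have "- (u /\<^sub>R t) \<in> span S"
      using u by (intro span_neg span_scale)
    then have "infdist a (span S) \<le> norm (a + u /\<^sub>R t)"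
      using infdist_le[of "- (u /\<^sub>R t)" "span S" a] by (simp add: dist_norm)
    then have "infdist a (span S) * \<bar>t\<bar> \<le> norm (a + u /\<^sub>R t) * \<bar>t\<bar>"
      by (simp add: mult_right_mono)
    also have "\<dots> = norm (t *\<^sub>R (a + u /\<^sub>R t))"
      by (simp add: mult.commute)
    also have "t *\<^sub>R (a + u /\<^sub>R t) = t *\<^sub>R a + u"
      using False by (simp add: scaleR_add_right)
    finally show ?thesis .
  qed simp
  then show ?thesis
    using pos by (intro that[of "1 / infdist a (span S)"]) (auto simp: field_simps)
qed

lemma Cauchy_dominated:
  fixes f :: "nat \<Rightarrow> 'a::real_normed_vector" and g :: "nat \<Rightarrow> 'b::real_normed_vector"
  assumes "Cauchy f" "\<And>m n. norm (g m - g n) \<le> K * norm (f m - f n)"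
  shows "Cauchy g"
proof (rule CauchyI)
  fix e :: real assume "0 < e"
  \<comment> \<open>K may be zero or negative, so the positive number
    \<open>\<bar>K\<bar> + 1\<close> is the divisor.\<close>
  then obtain M where M: "\<And>m n. m \<ge> M \<Longrightarrow> n \<ge> M \<Longrightarrow> norm (f m - f n) < e / (\<bar>K\<bar> + 1)"
    using CauchyD[OF assms(1), of "e / (\<bar>K\<bar> + 1)"] by auto
  have "norm (g m - g n) < e" if "m \<ge> M" "n \<ge> M" for m n
  proof -
    have "norm (g m - g n) \<le> (\<bar>K\<bar> + 1) * norm (f m - f n)"
      using assms(2)[of m n] by (rule order_trans) (intro mult_right_mono, auto)
    also have "\<dots> < e"
      using M[OF that] by (simp add: pos_less_divide_eq mult.commute)
    finally show ?thesis .
  qed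
  then show "\<exists>M. \<forall>m\<ge>M. \<forall>n\<ge>M. norm (g m - g n) < e" by blast
qed

text \<open>Induction on the generators. For a Cauchy sequence in the enlarged span,
  \<open>span_insert_scalar_bound\<close> makes the coefficients of the new vector Cauchy, hence
  also the remainders in \<open>span S\<close>; both then converge. The result supplies the closed
  spans which that bound requires.\<close>

lemma complete_span_finite:
  fixes S :: "'a::real_normed_vector set"
  assumes "finite S"
  shows "complete (span S)"
  using assms
proof (induction S rule: finite_induct)
  case empty
  then show ?case by (simp add: compact_imp_complete)
next
  case (insert a S)
  show ?case
  proof (cases "a \<in> span S")
    case True
    then show ?thesis using insert.IH by (simp add: span_redundant)
  next
    case False
    obtain K where K: "0 < K" "\<And>t u. u \<in> span S \<Longrightarrow> \<bar>t\<bar> \<le> K * norm (t *\<^sub>R a + u)"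
      using span_insert_scalar_bound[OF complete_imp_closed[OF insert.IH] False] by metis
    show ?thesis
    proof (rule completeI)
      fix f assume f: "\<forall>n. f n \<in> span (insert a S)" and "Cauchy f"
      from f have "\<forall>n. \<exists>t. f n - t *\<^sub>R a \<in> span S"
        by (simp add: span_breakdown_eq)
      then obtain t where t: "\<And>n. f n - t n *\<^sub>R a \<in> span S" by metis
      have bound: "\<bar>t m - t n\<bar> \<le> K * norm (f m - f n)" for m n
      proof -
        have "(f m - t m *\<^sub>R a) - (f n - t n *\<^sub>R a) \<in> span S" by (intro span_diff t)
        from K(2)[OF this, of "t m - t n"] show ?thesis by (simp add: algebra_simps)
      qed
      have "Cauchy t"
        using bound by (intro Cauchy_dominated[OF \<open>Cauchy f\<close>]) simp
      then obtain t0 where t0: "t \<longlonglongrightarrow> t0"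
        using Cauchy_convergent_iff convergent_def by blast
      have "norm ((f m - t m *\<^sub>R a) - (f n - t n *\<^sub>R a)) \<le> (1 + K * norm a) * norm (f m - f n)" for m n
      proof -
        have "norm ((f m - t m *\<^sub>R a) - (f n - t n *\<^sub>R a)) = norm ((f m - f n) - (t m - t n) *\<^sub>R a)"
          by (simp add: algebra_simps)
        also have "\<dots> \<le> norm (f m - f n) + \<bar>t m - t n\<bar> * norm a"
          using norm_triangle_ineq4[of "f m - f n" "(t m - t n) *\<^sub>R a"] by simp
        also have "\<dots> \<le> norm (f m - f n) + (K * norm (f m - f n)) * norm a"
          using bound by (intro add_left_mono mult_right_mono) auto
        finally show ?thesis by (simp add: algebra_simps)
      qed
      then have "Cauchy (\<lambda>n. f n - t n *\<^sub>R a)"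
        by (rule Cauchy_dominated[OF \<open>Cauchy f\<close>])
      then obtain u where u: "u \<in> span S" "(\<lambda>n. f n - t n *\<^sub>R a) \<longlonglongrightarrow> u"
        using insert.IH[unfolded complete_def, rule_format, of "\<lambda>n. f n - t n *\<^sub>R a"] t by blast
      have "(\<lambda>n. (f n - t n *\<^sub>R a) + t n *\<^sub>R a) \<longlonglongrightarrow> u + t0 *\<^sub>R a"
        by (intro tendsto_intros u t0)
      then have "f \<longlonglongrightarrow> u + t0 *\<^sub>R a" by simp
      moreover have "u + t0 *\<^sub>R a \<in> span (insert a S)"
        using u(1) by (auto simp: span_breakdown_eq intro: exI[of _ t0])
      ultimately show "\<exists>l\<in>span (insert a S). f \<longlonglongrightarrow> l" by blast
    qed
  qed
qed

text \<open>The coordinates belong to a basis extracted from \<open>B0\<close>. Each is bounded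
  because its basis vector has positive distance from the span of the others.\<close>

lemma finite_basis_coordinates:
  fixes B0 :: "'a::real_normed_vector set"
  assumes "finite B0" "span B0 = UNIV"
  obtains B :: "'a set" and r where "finite B" "\<And>b. b \<in> B \<Longrightarrow> bounded_linear (r b)"
    "\<And>v. v = (\<Sum>b\<in>B. r b v *\<^sub>R b)"
proof -
  obtain B where B: "B \<subseteq> B0" "independent B" "B0 \<subseteq> span B"
    using maximal_independent_subset[of B0] by blast
  have fin: "finite B" using B(1) assms(1) finite_subset by blast
  have sp: "span B = UNIV"
    using B(3) assms(2) span_mono[of B0 "span B"] by (auto simp: span_span)
  have expand: "v = (\<Sum>b\<in>B. representation B v b *\<^sub>R b)" for v
    using sum_representation_eq[OF B(2), of v B] fin sp by simp
  have "bounded_linear (\<lambda>v. representation B v b)" if b: "b \<in> B" for b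
  proof -
    have "b \<notin> span (B - {b})"
      using B(2) b by (auto simp: dependent_def)
    then obtain K where K: "\<And>t u. u \<in> span (B - {b}) \<Longrightarrow> \<bar>t\<bar> \<le> K * norm (t *\<^sub>R b + u)"
      using span_insert_scalar_bound[OF complete_imp_closed[OF complete_span_finite]] fin
      by (metis finite_Diff)
    show ?thesis
    proof (rule bounded_linear_intro)
      fix v
      have "v = representation B v b *\<^sub>R b + (\<Sum>c\<in>B - {b}. representation B v c *\<^sub>R c)"
        using expand[of v] sum.remove[OF fin b, of "\<lambda>c. representation B v c *\<^sub>R c"] by simp
      moreover have "(\<Sum>c\<in>B - {b}. representation B v c *\<^sub>R c) \<in> span (B - {b})"
        by (intro span_sum span_scale span_base)
      ultimately show "norm (representation B v b) \<le> norm v * K"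
        using K[of "\<Sum>c\<in>B - {b}. representation B v c *\<^sub>R c" "representation B v b"]
        by (simp add: mult.commute)
    qed (simp_all add: representation_add[OF B(2)] representation_scale[OF B(2)] sp)
  qed
  then show ?thesis using that[of B "\<lambda>b v. representation B v b"] fin expand by blast
qed


section \<open>Closure properties of smooth functions\<close>

lemma frechet_derivative_cong_open:
  assumes "open S" "x \<in> S" "\<And>y. y \<in> S \<Longrightarrow> f y = g y"
  shows "frechet_derivative f (at x) = frechet_derivative g (at x)"
proof -
  \<comment> \<open>\<open>frechet_derivative\<close> is a choice from the predicate
    \<open>has_derivative\<close>, so equivalent predicates give equal values even where no
    derivative exists.\<close>
  have "(f has_derivative D) (at x) \<longleftrightarrow> (g has_derivative D) (at x)" for D
    using assms has_derivative_transform_within_open[of _ D x UNIV S] by metis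
  then show ?thesis by (simp add: frechet_derivative_def)
qed

lemma differentiable_cong_open:
  assumes "open S" "x \<in> S" "\<And>y. y \<in> S \<Longrightarrow> f y = g y" "f differentiable (at x)"
  shows "g differentiable (at x)"
  using assms has_derivative_transform_within_open[of f _ x UNIV S g]
  unfolding differentiable_def by blast

text \<open>Serves the inductions below, where a derivative is replaced on S by the formula that a
  differentiation rule provides.\<close>

lemma times_diff_on_cong:
  assumes "open S" "\<And>x. x \<in> S \<Longrightarrow> f x = g x" "times_diff_on n f S"
  shows "times_diff_on n g S"
  using assms(2,3)
proof (induction n arbitrary: f g)
  case 0
  then show ?case by (auto cong: continuous_on_cong)
next
  case (Suc n)
  have "g differentiable (at x)" if "x \<in> S" for x
    using differentiable_cong_open[OF assms(1) that, of f g] Suc.prems that by auto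
  moreover have "times_diff_on n (\<lambda>x. frechet_derivative g (at x) v) S" for v
  proof (rule Suc.IH)
    show "times_diff_on n (\<lambda>x. frechet_derivative f (at x) v) S" using Suc.prems by simp
  next
    fix x assume "x \<in> S"
    then show "frechet_derivative f (at x) v = frechet_derivative g (at x) v"
      using frechet_derivative_cong_open[OF assms(1), of x f g] Suc.prems by simp
  qed
  ultimately show ?case by simp
qed

lemma times_diff_on_Suc_imp:
  "times_diff_on (Suc n) f S \<Longrightarrow> times_diff_on n f S"
proof (induction n arbitrary: f)
  case 0
  then show ?case
    by (auto intro!: continuous_at_imp_continuous_on differentiable_imp_continuous_within)
next
  case (Suc n)
  have "times_diff_on n (\<lambda>x. frechet_derivative f (at x) v) S" for v
    using Suc.prems by (intro Suc.IH) simp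
  then show ?case using Suc.prems by simp
qed

text \<open>Continuity and derivatives at a point depend only on a neighbourhood of it. This glues
  regularity obtained in different charts of a target manifold.\<close>

lemma times_diff_on_local:
  assumes "\<And>x. x \<in> S \<Longrightarrow> \<exists>U. open U \<and> x \<in> U \<and> times_diff_on n f U"
  shows "times_diff_on n f S"
  using assms
proof (induction n arbitrary: f)
  case 0
  then show ?case
    by (auto intro!: continuous_at_imp_continuous_on simp: continuous_on_eq_continuous_at)
       (metis continuous_on_eq_continuous_at)
next
  case (Suc n)
  have "times_diff_on n (\<lambda>x. frechet_derivative f (at x) v) S" for v
  proof (rule Suc.IH)
    fix x assume "x \<in> S"
    from Suc.prems[OF this]
    show "\<exists>U. open U \<and> x \<in> U \<and> times_diff_on n (\<lambda>x. frechet_derivative f (at x) v) U" by auto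
  qed
  then show ?case using Suc.prems by auto
qed

section \<open>Constants, linear images, sums and products\<close>

lemma times_diff_on_const: "times_diff_on n (\<lambda>x. c) S"
  by (induction n arbitrary: c) (simp_all add: frechet_derivative_const)

lemma times_diff_on_linear:
  assumes "bounded_linear r" "open S" "times_diff_on n f S"
  shows "times_diff_on n (\<lambda>x. r (f x)) S"
  using assms(3)
proof (induction n arbitrary: f)
  case 0
  then show ?case using assms(1) by (auto intro: bounded_linear.continuous_on)
next
  case (Suc n)
  have der: "((\<lambda>x. r (f x)) has_derivative (\<lambda>v. r (frechet_derivative f (at x) v))) (at x)"
    if "x \<in> S" for x
    using Suc.prems that
    by (intro bounded_linear.has_derivative[OF assms(1)]) (simp flip: frechet_derivative_works)
  have "times_diff_on n (\<lambda>x. frechet_derivative (\<lambda>x. r (f x)) (at x) v) S" for v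
  proof (rule times_diff_on_cong[OF assms(2)])
    show "times_diff_on n (\<lambda>x. r (frechet_derivative f (at x) v)) S"
      using Suc.prems by (intro Suc.IH) simp
  qed (simp flip: frechet_derivative_at[OF der])
  then show ?case using der by (auto simp: differentiable_def)
qed

lemma times_diff_on_add:
  assumes "open S" "times_diff_on n f S" "times_diff_on n g S"
  shows "times_diff_on n (\<lambda>x. f x + g x) S"
  using assms(2,3)
proof (induction n arbitrary: f g)
  case 0
  then show ?case by (auto intro: continuous_on_add)
next
  case (Suc n)
  have der: "((\<lambda>x. f x + g x) has_derivative
      (\<lambda>v. frechet_derivative f (at x) v + frechet_derivative g (at x) v)) (at x)"
    if "x \<in> S" for x
    using Suc.prems that by (intro has_derivative_add) (simp_all flip: frechet_derivative_works)
  have "times_diff_on n (\<lambda>x. frechet_derivative (\<lambda>x. f x + g x) (at x) v) S" for v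
  proof (rule times_diff_on_cong[OF assms(1)])
    show "times_diff_on n (\<lambda>x. frechet_derivative f (at x) v + frechet_derivative g (at x) v) S"
      using Suc.prems by (intro Suc.IH) simp_all
  qed (simp flip: frechet_derivative_at[OF der])
  then show ?case using der by (auto simp: differentiable_def)
qed

lemma times_diff_on_sum:
  assumes "open S" "\<And>i. i \<in> I \<Longrightarrow> times_diff_on n (f i) S"
  shows "times_diff_on n (\<lambda>x. \<Sum>i\<in>I. f i x) S"
  using assms(2)
  by (induction I rule: infinite_finite_induct)
     (auto intro: times_diff_on_const times_diff_on_add[OF assms(1)])

lemma times_diff_on_scaleR:
  fixes f :: "'a::real_normed_vector \<Rightarrow> real"
  assumes "open S" "times_diff_on n f S" "times_diff_on n g S"
  shows "times_diff_on n (\<lambda>x. f x *\<^sub>R g x) S"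
  using assms(2,3)
proof (induction n arbitrary: f g)
  case 0
  then show ?case by (auto intro: continuous_on_scaleR)
next
  case (Suc n)
  have der: "((\<lambda>x. f x *\<^sub>R g x) has_derivative
      (\<lambda>v. f x *\<^sub>R frechet_derivative g (at x) v + frechet_derivative f (at x) v *\<^sub>R g x)) (at x)"
    if "x \<in> S" for x
    using Suc.prems that by (intro has_derivative_scaleR) (simp_all flip: frechet_derivative_works)
  have "times_diff_on n (\<lambda>x. frechet_derivative (\<lambda>x. f x *\<^sub>R g x) (at x) v) S" for v
  proof (rule times_diff_on_cong[OF assms(1)])
    \<comment> \<open>Each term of the product rule keeps one factor undifferentiated, whose order
      has to be lowered to n before the induction hypothesis applies.\<close>
    show "times_diff_on n (\<lambda>x. f x *\<^sub>R frechet_derivative g (at x) v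
        + frechet_derivative f (at x) v *\<^sub>R g x) S"
      using Suc.prems times_diff_on_Suc_imp[OF Suc.prems(1)] times_diff_on_Suc_imp[OF Suc.prems(2)]
      by (intro times_diff_on_add[OF assms(1)] Suc.IH) simp_all
  qed (simp flip: frechet_derivative_at[OF der])
  then show ?case using der by (auto simp: differentiable_def)
qed

text \<open>The shape taken by a linear map depending on x, applied to a vector \<open>f x\<close>
  that is expanded in a basis: \<open>g b x\<close> is its value on the basis vector b. Composition
  and multilinear evaluation both reduce to it.\<close>

lemma times_diff_on_coordinate_sum:
  fixes r :: "'i \<Rightarrow> 'b::real_normed_vector \<Rightarrow> real"
  assumes S: "open S" and r: "\<And>b. b \<in> B \<Longrightarrow> bounded_linear (r b)"
    and f: "times_diff_on n f S" and g: "\<And>b. b \<in> B \<Longrightarrow> times_diff_on n (g b) S"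
  shows "times_diff_on n (\<lambda>x. \<Sum>b\<in>B. r b (f x) *\<^sub>R g b x) S"
  using times_diff_on_sum[OF S, of B n "\<lambda>b x. r b (f x) *\<^sub>R g b x"]
    times_diff_on_scaleR[OF S times_diff_on_linear[OF r S f] g] by blast

section \<open>Chain rule and composition\<close>

lemma frechet_derivative_chain:
  assumes "f differentiable (at x)" "g differentiable (at (f x))"
  shows "frechet_derivative (\<lambda>y. g (f y)) (at x) v =
    frechet_derivative g (at (f x)) (frechet_derivative f (at x) v)"
  using frechet_derivative_compose[of f x g] assms by (simp add: o_def)

text \<open>
  The direction \<open>Df(x) v\<close> varies with \<open>x\<close>, whereas \<open>times_diff_on\<close> controls derivatives in fixed
  directions only; hence the expansion in a basis.
\<close>

lemma times_diff_on_compose: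
  fixes f :: "'a::real_normed_vector \<Rightarrow> 'b::real_normed_vector"
  assumes fd: "\<exists>B::'b set. finite B \<and> span B = UNIV"
    and S: "open S" and T: "f ` S \<subseteq> T"
    and "times_diff_on n f S" "times_diff_on n g T"
  shows "times_diff_on n (\<lambda>x. g (f x)) S"
  using assms(4,5)
proof (induction n arbitrary: g)
  case 0
  then show ?case using T by (auto intro: continuous_on_compose2)
next
  case (Suc n)
  obtain B :: "'b set" and r where B: "finite B" "\<And>b. b \<in> B \<Longrightarrow> bounded_linear (r b)"
    "\<And>v. v = (\<Sum>b\<in>B. r b v *\<^sub>R b)"
    using fd finite_basis_coordinates by metis
  have df: "f differentiable (at x)" and dg: "g differentiable (at (f x))" if "x \<in> S" for x
    using Suc.prems T that image_subset_iff[of f S T] by simp_all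
  have "times_diff_on n (\<lambda>x. frechet_derivative (\<lambda>x. g (f x)) (at x) v) S" for v
  proof (rule times_diff_on_cong[OF S])
    show "times_diff_on n (\<lambda>x. \<Sum>b\<in>B. r b (frechet_derivative f (at x) v) *\<^sub>R
        frechet_derivative g (at (f x)) b) S"
    proof (rule times_diff_on_coordinate_sum[OF S B(2)])
      show "times_diff_on n (\<lambda>x. frechet_derivative f (at x) v) S"
        using Suc.prems by simp
      \<comment> \<open>The inner map stays fixed and only loses one order; the outer map becomes
        its own derivative in the fixed direction b, which is why the induction generalises over
        g.\<close>
      show "times_diff_on n (\<lambda>x. frechet_derivative g (at (f x)) b) S" for b
        using Suc.IH[OF times_diff_on_Suc_imp[OF Suc.prems(1)], of "\<lambda>y. frechet_derivative g (at y) b"]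
          Suc.prems(2) by simp
    qed
  next
    fix x assume x: "x \<in> S"
    interpret linear "frechet_derivative g (at (f x))"
      using dg[OF x] by (rule linear_frechet_derivative)
    have "frechet_derivative (\<lambda>x. g (f x)) (at x) v =
        frechet_derivative g (at (f x)) (\<Sum>b\<in>B. r b (frechet_derivative f (at x) v) *\<^sub>R b)"
      using frechet_derivative_chain[OF df[OF x] dg[OF x], of v] B(3) by simp
    then show "(\<Sum>b\<in>B. r b (frechet_derivative f (at x) v) *\<^sub>R frechet_derivative g (at (f x)) b) =
        frechet_derivative (\<lambda>x. g (f x)) (at x) v"
      by (simp add: sum scale)
  qed
  moreover have "(\<lambda>x. g (f x)) differentiable (at x)" if "x \<in> S" for x
    using differentiable_chain_at[OF df[OF that] dg[OF that]] by (simp add: o_def)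
  ultimately show ?case by simp
qed

section \<open>Smooth functions: derivatives, composition, multilinear evaluation\<close>

lemma smooth_on_cong:
  assumes "open S" "\<And>x. x \<in> S \<Longrightarrow> f x = g x" "smooth_on f S"
  shows "smooth_on g S"
  using times_diff_on_cong[OF assms(1,2)] assms(3) by (simp add: smooth_on_def)

lemma smooth_on_imp_times_diff_on: "smooth_on f S \<Longrightarrow> times_diff_on n f S"
  by (simp add: smooth_on_def)

lemma smooth_on_imp_differentiable: "smooth_on f S \<Longrightarrow> x \<in> S \<Longrightarrow> f differentiable (at x)"
  using smooth_on_imp_times_diff_on[of f S "Suc 0"] by simp

lemma smooth_on_frechet_derivative:
  assumes "smooth_on f S"
  shows "smooth_on (\<lambda>x. frechet_derivative f (at x) v) S"
  unfolding smooth_on_def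
proof
  fix n
  show "times_diff_on n (\<lambda>x. frechet_derivative f (at x) v) S"
    using smooth_on_imp_times_diff_on[OF assms, of "Suc n"] by simp
qed

lemma smooth_on_compose:
  fixes f :: "'a::real_normed_vector \<Rightarrow> 'b::real_normed_vector"
  assumes "\<exists>B::'b set. finite B \<and> span B = UNIV" "open S" "f ` S \<subseteq> T" "smooth_on f S" "smooth_on g T"
  shows "smooth_on (\<lambda>x. g (f x)) S"
  unfolding smooth_on_def
  using times_diff_on_compose[OF assms(1-3) smooth_on_imp_times_diff_on[OF assms(4)]
      smooth_on_imp_times_diff_on[OF assms(5)]] by (rule allI)

text \<open>Smoothness of A is given for constant arguments only. Expanding the varying arguments in
  a basis, one slot at a time, reduces to these.\<close>

lemma smooth_on_multilinear:
  fixes A :: "'a::real_normed_vector \<Rightarrow> (nat \<Rightarrow> 'b::real_normed_vector) \<Rightarrow> real"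
  assumes fd: "\<exists>B::'b set. finite B \<and> span B = UNIV" and S: "open S"
    and ext: "\<And>x v w. x \<in> S \<Longrightarrow> \<forall>i<k. v i = w i \<Longrightarrow> A x v = A x w"
    and lin: "\<And>x v i. x \<in> S \<Longrightarrow> i < k \<Longrightarrow> linear (\<lambda>z. A x (v(i := z)))"
    and A: "\<And>v. smooth_on (\<lambda>x. A x v) S"
    and u: "\<And>i. i < k \<Longrightarrow> smooth_on (u i) S"
  shows "smooth_on (\<lambda>x. A x (\<lambda>i. u i x)) S"
proof -
  obtain B :: "'b set" and r where B: "finite B" "\<And>b. b \<in> B \<Longrightarrow> bounded_linear (r b)"
    "\<And>v. v = (\<Sum>b\<in>B. r b v *\<^sub>R b)"
    using fd finite_basis_coordinates by metis
  \<comment> \<open>The first m slots vary and the others hold w. The claim is made for every w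
    because the induction step puts basis vectors into slot m.\<close>
  have "times_diff_on n (\<lambda>x. A x (\<lambda>i. if i < m then u i x else w i)) S" if "m \<le> k" for m n w
    using that
  proof (induction m arbitrary: w)
    case 0
    show ?case using A[of w, unfolded smooth_on_def, rule_format, of n] by simp
  next
    case (Suc m)
    show ?case
    proof (rule times_diff_on_cong[OF S])
      show "times_diff_on n (\<lambda>x. \<Sum>b\<in>B. r b (u m x) *\<^sub>R
          A x (\<lambda>i. if i < m then u i x else (w(m := b)) i)) S"
        using Suc.prems u[of m]
        by (intro times_diff_on_coordinate_sum[OF S B(2)] Suc.IH) (simp_all add: smooth_on_def)
    next
      fix x assume x: "x \<in> S"
      define v where "v = (\<lambda>i. if i < m then u i x else w i)"
      interpret linear "\<lambda>z. A x (v(m := z))"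
        using lin x Suc.prems by simp
      have upd: "(\<lambda>i. if i < m then u i x else (w(m := b)) i) = v(m := b)" for b
        by (auto simp: v_def fun_eq_iff)
      have "(\<lambda>i. if i < Suc m then u i x else w i) = v(m := u m x)"
        by (auto simp: v_def fun_eq_iff less_Suc_eq)
      then have "A x (\<lambda>i. if i < Suc m then u i x else w i) =
          A x (v(m := \<Sum>b\<in>B. r b (u m x) *\<^sub>R b))"
        using B(3)[of "u m x"] by simp
      also have "\<dots> = (\<Sum>b\<in>B. r b (u m x) *\<^sub>R A x (v(m := b)))"
        by (simp add: sum scale)
      finally show "(\<Sum>b\<in>B. r b (u m x) *\<^sub>R A x (\<lambda>i. if i < m then u i x else (w(m := b)) i)) =
          A x (\<lambda>i. if i < Suc m then u i x else w i)"
        unfolding upd by simp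
    qed
  qed
  \<comment> \<open>For \<open>m = k\<close> all relevant slots vary. The filler 0 beyond them is
    harmless by \<open>ext\<close>.\<close>
  from this[of k] have "times_diff_on n (\<lambda>x. A x (\<lambda>i. if i < k then u i x else 0)) S" for n
    by simp
  moreover have "A x (\<lambda>i. if i < k then u i x else 0) = A x (\<lambda>i. u i x)" if "x \<in> S" for x
    by (rule ext[OF that]) simp
  ultimately show ?thesis
    using smooth_on_cong[OF S, of "\<lambda>x. A x (\<lambda>i. if i < k then u i x else 0)" "\<lambda>x. A x (\<lambda>i. u i x)"]
    by (simp add: smooth_on_def)
qed


section \<open>Coordinate representations of smooth maps\<close>

text \<open>A common form for differentials and changes of components: \<open>tan_of_comp\<close> is
  the derivative of such a representation of the identity map, so one chain rule covers
  both.\<close>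

definition chart_rep ::
  "('a, 'e) chart \<Rightarrow> ('b, 'f) chart \<Rightarrow> ('a \<Rightarrow> 'b) \<Rightarrow> 'e \<Rightarrow> 'f" where
  "chart_rep c d f x = coord d (f (chart_inv c x))"

lemma pushforward_chart_rep:
  "pushforward M N f p =
    frechet_derivative (chart_rep (chart_at M p) (chart_at N (f p)) f) (at (coord (chart_at M p) p))"
  by (simp add: pushforward_def chart_rep_def[abs_def])

lemma tan_of_comp_chart_rep:
  "tan_of_comp M c p =
    frechet_derivative (chart_rep c (chart_at M p) (\<lambda>q. q)) (at (coord c p))"
  by (simp add: tan_of_comp_def chart_rep_def[abs_def])

lemma chart_at:
  assumes "smooth_manifold M" "p \<in> points M"
  shows "chart_at M p \<in> atlas M" "p \<in> cdom (chart_at M p)"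
proof -
  have "\<exists>c. c \<in> atlas M \<and> p \<in> cdom c"
    using assms unfolding smooth_manifold_def by blast
  from someI_ex[OF this] show "chart_at M p \<in> atlas M" "p \<in> cdom (chart_at M p)"
    by (simp_all add: chart_at_def)
qed

lemma chart_props:
  assumes "smooth_manifold M" "c \<in> atlas M"
  shows cdom_subset_points: "cdom c \<subseteq> points M"
    and inj_on_coord: "inj_on (coord c) (cdom c)"
    and open_coord_image: "openin (mtop M) U \<Longrightarrow> open (coord c ` (cdom c \<inter> U))"
proof -
  from assms have c: "openin (mtop M) (cdom c)" "open (coord c ` cdom c)"
    "homeomorphic_map (subtopology (mtop M) (cdom c)) (top_of_set (coord c ` cdom c)) (coord c)"
    by (auto simp: smooth_manifold_def is_chart_def)
  show sub: "cdom c \<subseteq> points M" using c(1) by (rule openin_subset)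
  show "inj_on (coord c) (cdom c)"
    using homeomorphic_imp_injective_map[OF c(3)] sub by (simp add: Int_absorb1)
  assume "openin (mtop M) U"
  then have "openin (subtopology (mtop M) (cdom c)) (cdom c \<inter> U)"
    by (rule openin_subtopology_Int2)
  then have "openin (top_of_set (coord c ` cdom c)) (coord c ` (cdom c \<inter> U))"
    using homeomorphic_imp_open_map[OF c(3)] unfolding open_map_def by blast
  \<comment> \<open>Relative openness suffices, since the whole chart image is open in the model
    space.\<close>
  then show "open (coord c ` (cdom c \<inter> U))"
    using c(2) openin_open_eq by blast
qed

lemma chart_inv_coord:
  "smooth_manifold M \<Longrightarrow> c \<in> atlas M \<Longrightarrow> p \<in> cdom c \<Longrightarrow> chart_inv c (coord c p) = p"
  unfolding chart_inv_def by (intro inv_into_f_f inj_on_coord)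

lemma smooth_map_image:
  "smooth_map M N f \<Longrightarrow> p \<in> points M \<Longrightarrow> f p \<in> points N"
  using continuous_map_image_subset_topspace[of "mtop M" "mtop N" f]
  by (auto simp: smooth_map_on_def)

text \<open>This is the smoothness of the transition maps, restated so that changes of chart become
  instances of results on smooth maps.\<close>

lemma smooth_map_id:
  assumes "smooth_manifold M"
  shows "smooth_map M M (\<lambda>p. p)"
proof -
  have "smooth_on (\<lambda>x. coord d (chart_inv c x)) (coord c ` {p \<in> cdom c \<inter> points M. p \<in> cdom d})"
    if c: "c \<in> atlas M" and d: "d \<in> atlas M" for c d
  proof -
    have "{p \<in> cdom c \<inter> points M. p \<in> cdom d} = cdom c \<inter> cdom d"
      using cdom_subset_points[OF assms c] by blast
    moreover have "smooth_on (\<lambda>x. coord d (chart_inv c x)) (coord c ` (cdom c \<inter> cdom d))"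
      using assms c d by (simp add: smooth_manifold_def)
    ultimately show ?thesis by simp
  qed
  then show ?thesis by (simp add: smooth_map_on_def)
qed

text \<open>Continuity of f makes the preimage of a chart domain open, and coordinates carry it to
  an open set, on which the representation can be differentiated.\<close>

lemma smooth_map_chart_domain:
  assumes "smooth_manifold M" "smooth_manifold N" "smooth_map M N f" "c \<in> atlas M" "d \<in> atlas N"
  shows "open (coord c ` {p \<in> cdom c. f p \<in> cdom d})"
    and "smooth_on (chart_rep c d f) (coord c ` {p \<in> cdom c. f p \<in> cdom d})"
proof -
  have sub: "{p \<in> cdom c \<inter> points M. f p \<in> cdom d} = {p \<in> cdom c. f p \<in> cdom d}"
    using cdom_subset_points[OF assms(1,4)] by blast
  show "smooth_on (chart_rep c d f) (coord c ` {p \<in> cdom c. f p \<in> cdom d})"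
    using assms(3-5) sub unfolding smooth_map_on_def chart_rep_def[abs_def] by force
  have "openin (mtop N) (cdom d)"
    using assms(2,5) by (simp add: smooth_manifold_def is_chart_def)
  then have "openin (mtop M) {p \<in> points M. f p \<in> cdom d}"
    using assms(3) by (auto simp: smooth_map_on_def intro: openin_continuous_map_preimage)
  then have "open (coord c ` (cdom c \<inter> {p \<in> points M. f p \<in> cdom d}))"
    by (rule open_coord_image[OF assms(1,4)])
  moreover have "cdom c \<inter> {p \<in> points M. f p \<in> cdom d} = {p \<in> cdom c. f p \<in> cdom d}"
    using sub by blast
  ultimately show "open (coord c ` {p \<in> cdom c. f p \<in> cdom d})" by simp
qed

lemma differentiable_chart_rep:
  assumes "smooth_manifold M" "smooth_manifold N" "smooth_map M N f" "c \<in> atlas M" "d \<in> atlas N"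
    "p \<in> cdom c" "f p \<in> cdom d"
  shows "chart_rep c d f differentiable (at (coord c p))"
  using assms by (intro smooth_on_imp_differentiable[OF smooth_map_chart_domain(2)]) auto

text \<open>Near p the map f lands in the domain of d, so the intermediate chart cancels and the
  ordinary chain rule applies.\<close>

lemma chart_rep_chain:
  assumes M: "smooth_manifold M" and N: "smooth_manifold N" and P: "smooth_manifold P"
    and f: "smooth_map M N f" and g: "smooth_map N P g"
    and h: "\<And>q. q \<in> points M \<Longrightarrow> h q = g (f q)"
    and c: "c \<in> atlas M" "p \<in> cdom c" and d: "d \<in> atlas N" "f p \<in> cdom d"
    and e: "e \<in> atlas P" "g (f p) \<in> cdom e"
  shows "frechet_derivative (chart_rep c e h) (at (coord c p)) v =
    frechet_derivative (chart_rep d e g) (at (coord d (f p)))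
      (frechet_derivative (chart_rep c d f) (at (coord c p)) v)"
proof -
  let ?S = "coord c ` {q \<in> cdom c. f q \<in> cdom d}"
  have fp: "chart_rep c d f (coord c p) = coord d (f p)"
    using chart_inv_coord[OF M c] by (simp add: chart_rep_def)
  have "chart_rep c e h x = chart_rep d e g (chart_rep c d f x)" if "x \<in> ?S" for x
  proof -
    from that obtain q where q: "q \<in> cdom c" "f q \<in> cdom d" "x = coord c q" by blast
    moreover have "q \<in> points M" using cdom_subset_points[OF M c(1)] q(1) by blast
    ultimately show ?thesis
      using chart_inv_coord[OF M c(1)] chart_inv_coord[OF N d(1)] h by (simp add: chart_rep_def)
  qed
  then have "frechet_derivative (chart_rep c e h) (at (coord c p)) =
      frechet_derivative (\<lambda>x. chart_rep d e g (chart_rep c d f x)) (at (coord c p))"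
    using c d by (intro frechet_derivative_cong_open[OF smooth_map_chart_domain(1)[OF M N f c(1) d(1)]])
      auto
  then show ?thesis
    using differentiable_chart_rep[OF M N f c(1) d(1) c(2) d(2)]
      differentiable_chart_rep[OF N P g d(1) e(1) d(2) e(2)]
    by (simp add: frechet_derivative_chain fp)
qed

section \<open>Differentials and changes of chart\<close>

lemma linear_pushforward:
  assumes "smooth_manifold M" "smooth_manifold N" "smooth_map M N f" "p \<in> points M"
  shows "linear (pushforward M N f p)"
  unfolding pushforward_chart_rep
  using assms smooth_map_image[OF assms(3,4)]
  by (intro linear_frechet_derivative differentiable_chart_rep[where M = M and N = N] chart_at)

lemma linear_tan_of_comp:
  assumes "smooth_manifold M" "c \<in> atlas M" "p \<in> cdom c"
  shows "linear (tan_of_comp M c p)"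
  unfolding tan_of_comp_chart_rep
  using assms cdom_subset_points[OF assms(1,2)]
  by (intro linear_frechet_derivative differentiable_chart_rep[where M = M and N = M]
      chart_at smooth_map_id) auto

text \<open>Keeping h apart from the composite allows one map to be differentiated along two
  factorisations, one of which may be valid on the points of M only.\<close>

lemma pushforward_chain:
  assumes "smooth_manifold M" "smooth_manifold N" "smooth_manifold P"
    "smooth_map M N f" "smooth_map N P g" "\<And>q. q \<in> points M \<Longrightarrow> h q = g (f q)" "p \<in> points M"
  shows "pushforward M P h p v = pushforward N P g (f p) (pushforward M N f p v)"
proof -
  have "f p \<in> points N" "g (f p) \<in> points P"
    using assms smooth_map_image by metis+
  then show ?thesis
    unfolding pushforward_chart_rep assms(6)[OF assms(7)]
    by (intro chart_rep_chain[where M = M and N = N and P = P] chart_at assms)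
qed

text \<open>The representation of f from c to the preferred chart at \<open>f p\<close> factors in
  two ways: through the identity of M followed by f, and through f followed by the identity of
  N.\<close>

lemma pushforward_tan_of_comp:
  assumes M: "smooth_manifold M" and N: "smooth_manifold N" and f: "smooth_map M N f"
    and c: "c \<in> atlas M" "p \<in> cdom c" and d: "d \<in> atlas N" "f p \<in> cdom d"
  shows "pushforward M N f p (tan_of_comp M c p v) =
    tan_of_comp N d (f p) (frechet_derivative (chart_rep c d f) (at (coord c p)) v)"
proof -
  have p: "p \<in> points M" using cdom_subset_points[OF M c(1)] c(2) by blast
  have fp: "f p \<in> points N" by (rule smooth_map_image[OF f p])
  have "frechet_derivative (chart_rep c (chart_at N (f p)) f) (at (coord c p)) v =
      pushforward M N f p (tan_of_comp M c p v)"
    unfolding pushforward_chart_rep tan_of_comp_chart_rep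
    by (rule chart_rep_chain[where M = M and N = M and P = N and f = "\<lambda>q. q"])
       (use M N f c p fp in \<open>auto intro!: smooth_map_id chart_at\<close>)
  moreover have "frechet_derivative (chart_rep c (chart_at N (f p)) f) (at (coord c p)) v =
      tan_of_comp N d (f p) (frechet_derivative (chart_rep c d f) (at (coord c p)) v)"
    unfolding tan_of_comp_chart_rep
    by (rule chart_rep_chain[where M = M and N = N and P = N and g = "\<lambda>q. q"])
       (use M N f c d p fp in \<open>auto intro!: smooth_map_id chart_at\<close>)
  ultimately show ?thesis by simp
qed


section \<open>Pull-back of differential forms\<close>

lemma fun_upd_map: "(\<lambda>i. g ((v(j := x)) i)) = (\<lambda>i. g (v i))(j := g x)"
  by auto

lemma alternating_formD:
  assumes "alternating_form k \<alpha>"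
  shows alternating_form_cong: "\<forall>i<k. v i = w i \<Longrightarrow> \<alpha> v = \<alpha> w"
    and alternating_form_linear: "i < k \<Longrightarrow> linear (\<lambda>x. \<alpha> (v(i := x)))"
    and alternating_form_zero: "i < k \<Longrightarrow> j < k \<Longrightarrow> i \<noteq> j \<Longrightarrow> v i = v j \<Longrightarrow> \<alpha> v = 0"
proof -
  note alt = assms[unfolded alternating_form_def]
  show "\<forall>i<k. v i = w i \<Longrightarrow> \<alpha> v = \<alpha> w"
    using alt[THEN conjunct1, THEN spec, THEN spec, of v w] by (rule mp)
  show "i < k \<Longrightarrow> linear (\<lambda>x. \<alpha> (v(i := x)))"
    using alt[THEN conjunct2, THEN conjunct1, THEN spec, of v] by simp
  show "i < k \<Longrightarrow> j < k \<Longrightarrow> i \<noteq> j \<Longrightarrow> v i = v j \<Longrightarrow> \<alpha> v = 0"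
    using alt[THEN conjunct2, THEN conjunct2, THEN spec, of v] by simp
qed

lemma alternating_form_comp_linear:
  fixes L :: "'a::real_vector \<Rightarrow> 'b::real_vector"
  assumes "alternating_form k \<alpha>" "linear L"
  shows "alternating_form k (\<lambda>v. \<alpha> (\<lambda>i. L (v i)))"
  unfolding alternating_form_def
proof (intro conjI allI impI)
  fix v :: "nat \<Rightarrow> 'a" and i assume "i < k"
  then have "linear (\<lambda>x. \<alpha> ((\<lambda>i. L (v i))(i := x)))"
    by (rule alternating_form_linear[OF assms(1)])
  from linear_compose[OF assms(2) this]
  show "linear (\<lambda>x. \<alpha> (\<lambda>j. L ((v(i := x)) j)))"
    by (simp only: fun_upd_map o_def)
next
  fix v w :: "nat \<Rightarrow> 'a" assume "\<forall>i<k. v i = w i"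
  then have "\<forall>i<k. L (v i) = L (w i)" by simp
  then show "\<alpha> (\<lambda>i. L (v i)) = \<alpha> (\<lambda>i. L (w i))"
    by (rule alternating_form_cong[OF assms(1)])
next
  fix v :: "nat \<Rightarrow> 'a" and i j assume "i < k" "j < k" "i \<noteq> j \<and> v i = v j"
  then show "\<alpha> (\<lambda>i. L (v i)) = 0"
    using alternating_form_zero[OF assms(1), of i j "\<lambda>i. L (v i)"] by simp
qed

text \<open>In charts the pull-back is the local expression of \<omega> along
  \<open>chart_rep c d f\<close>, evaluated on derivatives of that representation in fixed
  directions. Coefficients and arguments are smooth, so \<open>smooth_on_multilinear\<close>
  applies.\<close>

lemma smooth_on_pullback_chart:
  fixes M :: "('a, 'e::real_normed_vector) manifold"
    and N :: "('b, 'f::real_normed_vector) manifold"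
  assumes M: "smooth_manifold M" and N: "smooth_manifold N" and f: "smooth_map M N f"
    and \<omega>: "differential_form k N \<omega>" and c: "c \<in> atlas M" and d: "d \<in> atlas N"
  shows "smooth_on (\<lambda>x. pullback M N f \<omega> (chart_inv c x)
      (\<lambda>i. tan_of_comp M c (chart_inv c x) (v i))) (coord c ` {p \<in> cdom c. f p \<in> cdom d})"
    (is "smooth_on ?F ?S")
proof -
  \<comment> \<open>The local expression of \<omega> in d: y is a coordinate point, and w lists
    vectors by their components in d.\<close>
  define A where "A y w = \<omega> (chart_inv d y) (\<lambda>i. tan_of_comp N d (chart_inv d y) (w i))" for y w
  let ?G = "chart_rep c d f"
  have S: "open ?S" and G: "smooth_on ?G ?S"
    by (rule smooth_map_chart_domain[OF M N f c d])+
  have fd: "\<exists>B::'f set. finite B \<and> span B = UNIV"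
    using N by (simp add: smooth_manifold_def)
  have im: "?G ` ?S \<subseteq> coord d ` cdom d"
    using chart_inv_coord[OF M c] by (auto simp: chart_rep_def)
  have alt: "alternating_form k (A y)" if y: "y \<in> coord d ` cdom d" for y
  proof -
    from y obtain q where q: "q \<in> cdom d" "y = coord d q" by blast
    moreover have "q \<in> points N" using cdom_subset_points[OF N d] q(1) by blast
    ultimately have "alternating_form k (\<omega> q)" "linear (tan_of_comp N d q)"
      using \<omega> linear_tan_of_comp[OF N d] by (auto simp: differential_form_def)
    from alternating_form_comp_linear[OF this] show ?thesis
      using q chart_inv_coord[OF N d] by (simp add: A_def[abs_def])
  qed
  have "smooth_on (\<lambda>y. A y w) (coord d ` cdom d)" for w
    using \<omega> d by (simp add: differential_form_def A_def)
  then have A: "smooth_on (\<lambda>x. A (?G x) w) ?S" for w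
    by (rule smooth_on_compose[OF fd S im G])
  have alt_G: "alternating_form k (A (?G x))" if "x \<in> ?S" for x
    using alt im that by blast
  have smooth: "smooth_on (\<lambda>x. A (?G x) (\<lambda>i. frechet_derivative ?G (at x) (v i))) ?S"
  proof (rule smooth_on_multilinear[OF fd S, where k = k and A = "\<lambda>x. A (?G x)"
        and u = "\<lambda>i x. frechet_derivative ?G (at x) (v i)"])
    fix x and v w :: "nat \<Rightarrow> 'f" assume "x \<in> ?S" "\<forall>i<k. v i = w i"
    then show "A (?G x) v = A (?G x) w"
      by (rule alternating_form_cong[OF alt_G])
  next
    fix x i and v :: "nat \<Rightarrow> 'f" assume "x \<in> ?S" "i < k"
    then show "linear (\<lambda>z. A (?G x) (v(i := z)))"
      by (rule alternating_form_linear[OF alt_G])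
  qed (rule A, rule smooth_on_frechet_derivative[OF G])
  \<comment> \<open>By \<open>pushforward_tan_of_comp\<close>, the derivatives of \<open>?G\<close>
    are the components in d of the vectors that \<open>pullback\<close> passes to \<omega>.\<close>
  have "A (?G x) (\<lambda>i. frechet_derivative ?G (at x) (v i)) = ?F x" if "x \<in> ?S" for x
  proof -
    from that obtain p where p: "p \<in> cdom c" "f p \<in> cdom d" "x = coord c p" by blast
    then show ?thesis
      using chart_inv_coord[OF M c] chart_inv_coord[OF N d]
        pushforward_tan_of_comp[OF M N f c p(1) d p(2)]
      by (simp add: A_def pullback_def chart_rep_def[of c d f "coord c p"])
  qed
  then show ?thesis by (rule smooth_on_cong[OF S _ smooth])
qed

lemma differential_form_pullback:
  assumes M: "smooth_manifold M" and N: "smooth_manifold N" and f: "smooth_map M N f"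
    and \<omega>: "differential_form k N \<omega>"
  shows "differential_form k M (pullback M N f \<omega>)"
  unfolding differential_form_def
proof (intro conjI ballI allI)
  fix p assume p: "p \<in> points M"
  then have "alternating_form k (\<omega> (f p))"
    using \<omega> smooth_map_image[OF f p] by (simp add: differential_form_def)
  from alternating_form_comp_linear[OF this linear_pushforward[OF M N f p]]
  show "alternating_form k (pullback M N f \<omega> p)"
    by (simp add: pullback_def[abs_def])
next
  fix c v assume c: "c \<in> atlas M"
  show "smooth_on (\<lambda>x. pullback M N f \<omega> (chart_inv c x)
      (\<lambda>i. tan_of_comp M c (chart_inv c x) (v i))) (coord c ` cdom c)"
    unfolding smooth_on_def
  \<comment> \<open>The domain of c need not map into a single chart of N, so around each p the
    target chart at \<open>f p\<close> is used and the local results are glued.\<close>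
  proof (rule allI, rule times_diff_on_local)
    fix n x assume "x \<in> coord c ` cdom c"
    then obtain p where p: "p \<in> cdom c" "x = coord c p" by blast
    let ?d = "chart_at N (f p)"
    have "f p \<in> points N"
      using cdom_subset_points[OF M c] p(1) smooth_map_image[OF f] by blast
    then have d: "?d \<in> atlas N" "f p \<in> cdom ?d" by (rule chart_at[OF N])+
    let ?S = "coord c ` {q \<in> cdom c. f q \<in> cdom ?d}"
    have "open ?S" by (rule smooth_map_chart_domain(1)[OF M N f c d(1)])
    moreover have "x \<in> ?S" using p d(2) by blast
    moreover have "times_diff_on n (\<lambda>x. pullback M N f \<omega> (chart_inv c x)
        (\<lambda>i. tan_of_comp M c (chart_inv c x) (v i))) ?S"
      using smooth_on_pullback_chart[OF M N f \<omega> c d(1), of v] by (simp add: smooth_on_def)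
    ultimately show "\<exists>U. open U \<and> x \<in> U \<and> times_diff_on n (\<lambda>x. pullback M N f \<omega> (chart_inv c x)
        (\<lambda>i. tan_of_comp M c (chart_inv c x) (v i))) U"
      by blast
  qed
qed


section \<open>Morphisms compatible with connections\<close>

text \<open>The differential of \<open>F0\<close> after that of s equals the differential of
  \<open>s'\<close> after that of \<open>F1\<close>, and compatibility moves the horizontal
  projection across the latter. The maps s and \<open>s'\<close> are left general to serve both for
  sources and for targets.\<close>

lemma hor_form_pullback_compatible:
  assumes m: "smooth_manifold (arr X)" "smooth_manifold (obj X)"
      "smooth_manifold (arr Y)" "smooth_manifold (obj Y)"
    and F: "smooth_map (arr X) (arr Y) F1" "smooth_map (obj X) (obj Y) F0"
    and s: "smooth_map (arr X) (obj X) s" and s': "smooth_map (arr Y) (obj Y) s'"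
    and square: "\<And>\<gamma>. \<gamma> \<in> points (arr X) \<Longrightarrow> s' (F1 \<gamma>) = F0 (s \<gamma>)"
    and comp: "compatible X HX Y HY F1" and \<gamma>: "\<gamma> \<in> points (arr X)"
  shows "hor_form X HX (pullback (arr X) (obj X) s (pullback (obj X) (obj Y) F0 \<omega>)) \<gamma> v =
    hor_form Y HY (pullback (arr Y) (obj Y) s' \<omega>) (F1 \<gamma>)
      (\<lambda>i. pushforward (arr X) (arr Y) F1 \<gamma> (v i))"
proof -
  have "pushforward (obj X) (obj Y) F0 (s \<gamma>) (pushforward (arr X) (obj X) s \<gamma> (hor X HX \<gamma> w)) =
      pushforward (arr Y) (obj Y) s' (F1 \<gamma>) (hor Y HY (F1 \<gamma>) (pushforward (arr X) (arr Y) F1 \<gamma> w))"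
    for w
  proof -
    \<comment> \<open>This diagonal of the square is differentiated along both sides; its second
      factorisation, by \<open>square\<close>, holds on the arrows of X.\<close>
    let ?h = "\<lambda>q. F0 (s q)"
    have "pushforward (arr X) (obj Y) ?h \<gamma> (hor X HX \<gamma> w) =
        pushforward (obj X) (obj Y) F0 (s \<gamma>) (pushforward (arr X) (obj X) s \<gamma> (hor X HX \<gamma> w))"
      by (rule pushforward_chain) (use m F s \<gamma> in auto)
    moreover have "pushforward (arr X) (obj Y) ?h \<gamma> (hor X HX \<gamma> w) =
        pushforward (arr Y) (obj Y) s' (F1 \<gamma>)
          (pushforward (arr X) (arr Y) F1 \<gamma> (hor X HX \<gamma> w))"
      by (rule pushforward_chain) (use m F s' \<gamma> square in auto)
    ultimately show ?thesis using comp \<gamma> by (simp add: compatible_def)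
  qed
  then show ?thesis
    using square[OF \<gamma>] by (simp add: hor_form_def pullback_def)
qed

theorem proposition4p3p5:
  fixes X :: "('x1, 'ex1::real_normed_vector, 'x0, 'ex0::real_normed_vector) groupoid"
    and Y :: "('y1, 'ey1::real_normed_vector, 'y0, 'ey0::real_normed_vector) groupoid"
    and HX :: "'x1 \<Rightarrow> 'ex1 set"
    and HY :: "'y1 \<Rightarrow> 'ey1 set"
    and F1 :: "'x1 \<Rightarrow> 'y1"
    and F0 :: "'x0 \<Rightarrow> 'y0"
    and k :: nat
    and \<omega> :: "('y0, 'ey0) form"
  assumes "lie_groupoid X" and "lie_groupoid Y"
    and "integrable_connection X HX" and "integrable_connection Y HY"
    and "lie_groupoid_morphism X Y F1 F0"
    and "compatible X HX Y HY F1"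
    and "differential_form k (obj Y) \<omega>"
    and "groupoid_form k Y HY \<omega>"
  shows "groupoid_form k X HX (pullback (obj X) (obj Y) F0 \<omega>)"
proof -
  have X: "smooth_manifold (arr X)" "smooth_manifold (obj X)"
      "smooth_map (arr X) (obj X) (src X)" "smooth_map (arr X) (obj X) (tgt X)"
    and Y: "smooth_manifold (arr Y)" "smooth_manifold (obj Y)"
      "smooth_map (arr Y) (obj Y) (src Y)" "smooth_map (arr Y) (obj Y) (tgt Y)"
    using assms(1,2) by (simp_all add: lie_groupoid_def)
  have F: "smooth_map (arr X) (arr Y) F1" "smooth_map (obj X) (obj Y) F0"
    and src: "\<And>\<gamma>. \<gamma> \<in> points (arr X) \<Longrightarrow> src Y (F1 \<gamma>) = F0 (src X \<gamma>)"
    and tgt: "\<And>\<gamma>. \<gamma> \<in> points (arr X) \<Longrightarrow> tgt Y (F1 \<gamma>) = F0 (tgt X \<gamma>)"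
    using assms(5) by (simp_all add: lie_groupoid_morphism_def)
  note hor_form = hor_form_pullback_compatible[OF X(1,2) Y(1,2) F]
  show ?thesis
    unfolding groupoid_form_def
  proof (intro conjI ballI ext)
    show "differential_form k (obj X) (pullback (obj X) (obj Y) F0 \<omega>)"
      by (rule differential_form_pullback[OF X(2) Y(2) F(2) assms(7)])
  next
    fix \<gamma> v assume \<gamma>: "\<gamma> \<in> points (arr X)"
    \<comment> \<open>The condition on \<omega> is used at the arrow \<open>F1 \<gamma>\<close> of
      Y; the two instances of \<open>hor_form\<close> carry it back to \<gamma>.\<close>
    have "hor_form Y HY (pullback (arr Y) (obj Y) (src Y) \<omega>) (F1 \<gamma>) =
        hor_form Y HY (pullback (arr Y) (obj Y) (tgt Y) \<omega>) (F1 \<gamma>)"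
      using assms(8) smooth_map_image[OF F(1) \<gamma>] by (simp add: groupoid_form_def)
    then show "hor_form X HX (pullback (arr X) (obj X) (src X) (pullback (obj X) (obj Y) F0 \<omega>)) \<gamma> v =
        hor_form X HX (pullback (arr X) (obj X) (tgt X) (pullback (obj X) (obj Y) F0 \<omega>)) \<gamma> v"
      by (simp add: hor_form[OF X(3) Y(3) src assms(6) \<gamma>] hor_form[OF X(4) Y(4) tgt assms(6) \<gamma>])
  qed
qed

end
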